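(* Let $X$ be a Banach space and let $U_1(t,s)$ and $U_2(t,s)$ be two-parameter $C_0$-semigroups of operators (evolution operators) in $X$, generated by generally unbounded operators $A_1(t)$ and $A_2(t)$ in $X$, respectively. Let $a_i(t,s) = \mathrm{Log}(U_i(t,s)+\kappa I)$, $i=1,2$, so that $\partial_t a_1(t,s)$ and $\partial_t a_2(t,s)$ are the alternative infinitesimal generators for $A_1(t)$ and $A_2(t)$. Then $$ e^{a_1(t,s)}\, a_2(t,s)\, e^{-a_1(t,s)} = a_2(t,s) + [a_1(t,s),a_2(t,s)] + \tfrac12\,[a_1(t,s),[a_1(t,s),a_2(t,s)]] + R_4(t,s) $$ is valid in $X$, where $R_4(t,s)$ consists of terms of order at least $4$ in $a_1(t,s),a_2(t,s)$.
   Context: $X$ is a finite- or infinite-dimensional Banach space, $B(X)$ the bounded operators on $X$, $I$ the identity, and $[A,B]=AB-BA$. Fix a finite interval $[0,T]$. For $i=1,2$, $U_i(t,s)$ is a two-parameter $C_0$-semigroup (evolution operator) on $X$: $U_i(t,s)\in B(X)$ is continuous with respect to both parameters $t,s$, $\|U_i(t,s)\|\le M_i e^{\omega_i(t-s)}$ for certain real numbers $M_i,\omega_i$, and $U_i(t,r)U_i(r,s)=U_i(t,s)$ for all $s\le r\le t$ in $[0,T]$. It is generated by $A_i(t):D(A_i(t))\to X$, $D(A_i(t))\subset X$ (in general unbounded), meaning that $U_i(t,s)$ solves $\partial_t u(t)=A_i(t)u(t)$ in $X$, with $\partial_t U_i(t,s)=A_i(t)U_i(t,s)$. $\mathrm{Log}$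 is the principal branch of the logarithm, defined on operators by the Riesz-Dunford integral. The complex number $\kappa$, common to $i=1,2$, has sufficiently large modulus and is chosen so that $\mathrm{Log}(U_i(t,s)+\kappa I)$ is defined by this integral (as a bounded operator on $X$); then $e^{a_i(t,s)}=U_i(t,s)+\kappa I$. The derivative $\partial_t a_i(t,s)$ is called the alternative infinitesimal generator for $A_i(t)$. The exponentials $e^{\pm a_i(t,s)}$ are defined by convergent power series. "Terms of order at least $k$ in $a_1,a_2$" means a bounded operator given by a convergent noncommutative power series in $a_1(t,s),a_2(t,s)$ all of whose terms have total degree at least $k$. *)

theory Defs
  imports "HOL-Complex_Analysis.Complex_Analysis"
begin

section \<open>Complex Banach spaces and their bounded operators\<close>

class complex_banach = banach +
  fixes scaleC :: "complex \<Rightarrow> 'a \<Rightarrow> 'a" (infixr "*\<^sub>C" 75)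
  assumes scaleC_add_right: "c *\<^sub>C (x + y) = c *\<^sub>C x + c *\<^sub>C y"
    and scaleC_add_left: "(b + c) *\<^sub>C x = b *\<^sub>C x + c *\<^sub>C x"
    and scaleC_scaleC: "b *\<^sub>C (c *\<^sub>C x) = (b * c) *\<^sub>C x"
    and scaleC_of_real: "complex_of_real r *\<^sub>C x = r *\<^sub>R x"
    and norm_scaleC: "norm (c *\<^sub>C x) = cmod c * norm x"

instantiation complex :: complex_banach
begin

definition scaleC_complex :: "complex \<Rightarrow> complex \<Rightarrow> complex" where
  "scaleC_complex c x = c * x"

instance
  by standard (simp_all add: scaleC_complex_def algebra_simps norm_mult scaleR_conv_of_real)

end

instantiation blinfun :: (real_normed_vector, complex_banach) complex_banach
begin

lift_definition scaleC_blinfun :: "complex \<Rightarrow> ('a \<Rightarrow>\<^sub>L 'b) \<Rightarrow> ('a \<Rightarrow>\<^sub>L 'b)" is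
  "\<lambda>c f x. c *\<^sub>C f x"
proof -
  fix c :: complex and f :: "'a \<Rightarrow> 'b"
  assume "bounded_linear f"
  then interpret bounded_linear f .
  obtain K where K: "\<And>x. norm (f x) \<le> norm x * K"
    using bounded by blast
  show "bounded_linear (\<lambda>x. c *\<^sub>C f x)"
  proof (rule bounded_linear_intro[where K = "cmod c * K"])
    show "c *\<^sub>C f (x + y) = c *\<^sub>C f x + c *\<^sub>C f y" for x y
      by (simp add: add scaleC_add_right)
    show "c *\<^sub>C f (r *\<^sub>R x) = r *\<^sub>R (c *\<^sub>C f x)" for r x
      by (metis scale scaleC_of_real scaleC_scaleC mult.commute)
    show "norm (c *\<^sub>C f x) \<le> norm x * (cmod c * K)" for x
      using mult_left_mono[OF K[of x], of "cmod c"] by (simp add: norm_scaleC mult_ac)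
  qed
qed

instance
proof
  fix b c :: complex and r :: real and f g :: "'a \<Rightarrow>\<^sub>L 'b"
  show "c *\<^sub>C (f + g) = c *\<^sub>C f + c *\<^sub>C g"
    by (rule blinfun_eqI) (simp add: scaleC_blinfun.rep_eq blinfun.add_left scaleC_add_right)
  show "(b + c) *\<^sub>C f = b *\<^sub>C f + c *\<^sub>C f"
    by (rule blinfun_eqI) (simp add: scaleC_blinfun.rep_eq blinfun.add_left scaleC_add_left)
  show "b *\<^sub>C (c *\<^sub>C f) = (b * c) *\<^sub>C f"
    by (rule blinfun_eqI) (simp add: scaleC_blinfun.rep_eq scaleC_scaleC)
  show "complex_of_real r *\<^sub>C f = r *\<^sub>R f"
    by (rule blinfun_eqI) (simp add: scaleC_blinfun.rep_eq scaleC_of_real blinfun.scaleR_left)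
  show "norm (c *\<^sub>C f) = cmod c * norm f"
  proof (rule antisym)
    have le: "norm (d *\<^sub>C h) \<le> cmod d * norm h" for d and h :: "'a \<Rightarrow>\<^sub>L 'b"
    proof (rule norm_blinfun_bound)
      show "norm (blinfun_apply (d *\<^sub>C h) x) \<le> cmod d * norm h * norm x" for x
        using mult_left_mono[OF norm_blinfun[of h x], of "cmod d"]
        by (simp add: scaleC_blinfun.rep_eq norm_scaleC mult.assoc)
    qed simp
    show "norm (c *\<^sub>C f) \<le> cmod c * norm f"
      by (rule le)
    show "cmod c * norm f \<le> norm (c *\<^sub>C f)"
    proof (cases "c = 0")
      case False
      have "inverse c *\<^sub>C (c *\<^sub>C f) = complex_of_real 1 *\<^sub>C f"
        by (rule blinfun_eqI) (simp add: scaleC_blinfun.rep_eq scaleC_scaleC False)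
      also have "\<dots> = f"
        by (rule blinfun_eqI) (simp only: scaleC_blinfun.rep_eq scaleC_of_real scaleR_one)
      finally have "norm f \<le> inverse (cmod c) * norm (c *\<^sub>C f)"
        using le[of "inverse c" "c *\<^sub>C f"] by (simp add: norm_inverse)
      then show ?thesis
        using False by (simp add: field_simps)
    qed simp
  qed
qed

end

text \<open>
  \<open>'x \<Rightarrow>\<^sub>L 'x\<close> consists of the bounded real-linear operators; \<open>B(X)\<close> is the
  subset of those which are complex-linear.
\<close>

definition bounded_ops :: "('x::complex_banach \<Rightarrow>\<^sub>L 'x) set" where
  "bounded_ops = {A. \<forall>c x. blinfun_apply A (c *\<^sub>C x) = c *\<^sub>C A x}"

definition commutator :: "('x::complex_banach \<Rightarrow>\<^sub>L 'x) \<Rightarrow> ('x \<Rightarrow>\<^sub>L 'x) \<Rightarrow> ('x \<Rightarrow>\<^sub>L 'x)" where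
  "commutator A B = (A o\<^sub>L B) - (B o\<^sub>L A)"

text \<open>
  The library function \<open>exp\<close> is not available on \<open>'x \<Rightarrow>\<^sub>L 'x\<close>, which is not an instance
  of \<open>real_normed_algebra_1\<close>.
\<close>

definition op_exp :: "('x::complex_banach \<Rightarrow>\<^sub>L 'x) \<Rightarrow> ('x \<Rightarrow>\<^sub>L 'x)" where
  "op_exp A = (\<Sum>n. (1 / fact n) *\<^sub>R (((o\<^sub>L) A ^^ n) id_blinfun))"


section \<open>Riesz-Dunford integral and operator logarithm\<close>

definition is_op_inverse :: "('x::complex_banach \<Rightarrow>\<^sub>L 'x) \<Rightarrow> ('x \<Rightarrow>\<^sub>L 'x) \<Rightarrow> bool" where
  "is_op_inverse A B \<longleftrightarrow> A o\<^sub>L B = id_blinfun \<and> B o\<^sub>L A = id_blinfun"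

text \<open>The inverse of a complex-linear operator is automatically complex-linear.\<close>

definition op_spectrum :: "('x::complex_banach \<Rightarrow>\<^sub>L 'x) \<Rightarrow> complex set" where
  "op_spectrum A = {z. \<nexists>B. is_op_inverse (z *\<^sub>C id_blinfun - A) B}"

definition resolvent :: "('x::complex_banach \<Rightarrow>\<^sub>L 'x) \<Rightarrow> complex \<Rightarrow> ('x \<Rightarrow>\<^sub>L 'x)" where
  "resolvent A z = (THE B. is_op_inverse (z *\<^sub>C id_blinfun - A) B)"

text \<open>
  A closed piecewise continuously differentiable curve in \<open>\<Omega>\<close> that winds once around the
  spectrum of \<open>A\<close> and not at all around the complement of \<open>\<Omega>\<close>.
\<close>

definition dunford_contour ::
  "complex set \<Rightarrow> ('x::complex_banach \<Rightarrow>\<^sub>L 'x) \<Rightarrow> (real \<Rightarrow> complex) \<Rightarrow> bool" where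
  "dunford_contour \<Omega> A \<gamma> \<longleftrightarrow>
     valid_path \<gamma> \<and> pathfinish \<gamma> = pathstart \<gamma> \<and>
     path_image \<gamma> \<subseteq> \<Omega> - op_spectrum A \<and>
     (\<forall>z\<in>op_spectrum A. winding_number \<gamma> z = 1) \<and>
     (\<forall>z. z \<notin> \<Omega> \<longrightarrow> winding_number \<gamma> z = 0)"

text \<open>
  \<open>B = 1/(2\<pi>\<i>) \<integral>\<^bsub>\<gamma>\<^esub> f(z) (zI - A)\<^sup>-\<^sup>1 dz\<close>, with the operator-valued contour integral
  parametrised as in \<open>has_contour_integral\<close>. For open \<open>\<Omega>\<close> and holomorphic \<open>f\<close> the
  value does not depend on \<open>\<gamma>\<close>, by Cauchy's theorem.
\<close>

definition has_riesz_dunford ::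
  "complex set \<Rightarrow> (complex \<Rightarrow> complex) \<Rightarrow> ('x::complex_banach \<Rightarrow>\<^sub>L 'x) \<Rightarrow> ('x \<Rightarrow>\<^sub>L 'x) \<Rightarrow> bool" where
  "has_riesz_dunford \<Omega> f A B \<longleftrightarrow>
     (\<exists>\<gamma> J. dunford_contour \<Omega> A \<gamma> \<and>
        ((\<lambda>x. (f (\<gamma> x) * vector_derivative \<gamma> (at x within {0..1})) *\<^sub>C resolvent A (\<gamma> x))
           has_integral J) {0..1} \<and>
        B = (1 / (2 * of_real pi * \<i>)) *\<^sub>C J)"

text \<open>
  \<open>has_op_Log A B\<close>: the Riesz-Dunford integral defining the principal logarithm of \<open>A\<close>
  exists and equals \<open>B\<close>. The domain is the plane slit along the branch cut of \<open>Ln\<close>.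
\<close>

definition has_op_Log :: "('x::complex_banach \<Rightarrow>\<^sub>L 'x) \<Rightarrow> ('x \<Rightarrow>\<^sub>L 'x) \<Rightarrow> bool" where
  "has_op_Log A B \<longleftrightarrow> has_riesz_dunford (- \<real>\<^sub>\<le>\<^sub>0) Ln A B"


section \<open>Evolution operators and their generators\<close>

text \<open>
  Only the values \<open>U t s\<close> with \<open>0 \<le> s \<le> t \<le> T\<close> are meaningful. As usual for
  \<open>C\<^sub>0\<close>-semigroups, continuity is meant in the strong operator topology.
\<close>

definition evolution_operator ::
  "real \<Rightarrow> (real \<Rightarrow> real \<Rightarrow> ('x::complex_banach \<Rightarrow>\<^sub>L 'x)) \<Rightarrow> bool" where
  "evolution_operator T U \<longleftrightarrow>
     (\<forall>s t. 0 \<le> s \<and> s \<le> t \<and> t \<le> T \<longrightarrow> U t s \<in> bounded_ops) \<and>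
     (\<forall>x. continuous_on {(t, s). 0 \<le> s \<and> s \<le> t \<and> t \<le> T} (\<lambda>(t, s). U t s x)) \<and>
     (\<exists>M \<omega>. \<forall>s t. 0 \<le> s \<and> s \<le> t \<and> t \<le> T \<longrightarrow> norm (U t s) \<le> M * exp (\<omega> * (t - s))) \<and>
     (\<forall>s r t. 0 \<le> s \<and> s \<le> r \<and> r \<le> t \<and> t \<le> T \<longrightarrow> U t r o\<^sub>L U r s = U t s)"

definition linear_operator_on :: "'x::complex_banach set \<Rightarrow> ('x \<Rightarrow> 'x) \<Rightarrow> bool" where
  "linear_operator_on D A \<longleftrightarrow>
     0 \<in> D \<and>
     (\<forall>x\<in>D. \<forall>y\<in>D. x + y \<in> D \<and> A (x + y) = A x + A y) \<and>
     (\<forall>c. \<forall>x\<in>D. c *\<^sub>C x \<in> D \<and> A (c *\<^sub>C x) = c *\<^sub>C A x)"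

text \<open>
  The possibly unbounded operator at time \<open>t\<close> is \<open>A t\<close> restricted to the domain \<open>D t\<close>.
  The equation \<open>\<partial>\<^sub>t U(t,s) = A(t) U(t,s)\<close> is understood strongly, on initial values in the
  domain at time \<open>s\<close>, with one-sided derivatives at the end points of \<open>[s,T]\<close>.
\<close>

definition generates ::
  "real \<Rightarrow> (real \<Rightarrow> 'x::complex_banach set) \<Rightarrow> (real \<Rightarrow> 'x \<Rightarrow> 'x) \<Rightarrow>
   (real \<Rightarrow> real \<Rightarrow> ('x \<Rightarrow>\<^sub>L 'x)) \<Rightarrow> bool" where
  "generates T D A U \<longleftrightarrow>
     (\<forall>t\<in>{0..T}. linear_operator_on (D t) (A t)) \<and>
     (\<forall>s\<in>{0..T}. \<forall>x\<in>D s. \<forall>t\<in>{s..T}.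
        U t s x \<in> D t \<and>
        ((\<lambda>r. U r s x) has_vector_derivative A t (U t s x)) (at t within {s..T}))"


section \<open>Noncommutative power series in two operators\<close>

datatype letter = Fst | Snd

fun word_op :: "('x::complex_banach \<Rightarrow>\<^sub>L 'x) \<Rightarrow> ('x \<Rightarrow>\<^sub>L 'x) \<Rightarrow> letter list \<Rightarrow> ('x \<Rightarrow>\<^sub>L 'x)" where
  "word_op a b [] = id_blinfun"
| "word_op a b (Fst # w) = a o\<^sub>L word_op a b w"
| "word_op a b (Snd # w) = b o\<^sub>L word_op a b w"

text \<open>
  \<open>R\<close> is the sum, convergent in operator norm, of the power series with coefficients \<open>c\<close>,
  all of whose terms have total degree at least \<open>k\<close>.
\<close>

definition sum_of_terms_of_order_ge ::
  "nat \<Rightarrow> (letter list \<Rightarrow> complex) \<Rightarrow>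
   ('x::complex_banach \<Rightarrow>\<^sub>L 'x) \<Rightarrow> ('x \<Rightarrow>\<^sub>L 'x) \<Rightarrow> ('x \<Rightarrow>\<^sub>L 'x) \<Rightarrow> bool" where
  "sum_of_terms_of_order_ge k c a b R \<longleftrightarrow>
     (\<forall>w. length w < k \<longrightarrow> c w = 0) \<and>
     ((\<lambda>w. c w *\<^sub>C word_op a b w) has_sum R) UNIV"

end

theory Submission
  imports Defs
begin

text \<open>
  The exponential series for \<open>e\<^bsup>a\<^esup>\<close> and \<open>e\<^bsup>-a\<^esup>\<close> converge absolutely, so \<open>e\<^bsup>a\<^esup> b e\<^bsup>-a\<^esup>\<close> is
  the unconditional sum of \<open>(-1)\<^sup>k / (j! k!) a\<^sup>j b a\<^sup>k\<close> over all pairs \<open>(j, k)\<close>. The six pairs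
  with \<open>j + k < 3\<close> contribute the commutator terms, and the other pairs form the remainder.
  The remainder is complex-linear because the logarithms are: they are integrals of
  resolvents of complex-linear operators.
\<close>

section \<open>Complex-linear operators\<close>

lemma bounded_opsD: "A \<in> bounded_ops \<Longrightarrow> blinfun_apply A (c *\<^sub>C x) = c *\<^sub>C A x"
  by (simp add: bounded_ops_def)

lemma scaleC_minus_right: "c *\<^sub>C (- x) = - (c *\<^sub>C (x :: 'a::complex_banach))"
proof -
  have "0 *\<^sub>C (0 :: 'a) = 0"
    using scaleC_of_real[of 0 "0 :: 'a"] by simp
  \<comment> \<open>Scaling zero twice reduces an arbitrary scalar to the scalar 0: c 0 = c (0 0) =
    (c 0) 0, and the scalar 0 is real.\<close>
  then have "c *\<^sub>C (0 :: 'a) = 0"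
    by (metis mult_zero_right scaleC_scaleC)
  then show ?thesis
    using scaleC_add_right[of c x "- x"] by (simp add: eq_neg_iff_add_eq_0 add.commute)
qed

lemma scaleC_diff_right: "c *\<^sub>C (x - y) = c *\<^sub>C x - c *\<^sub>C (y :: 'a::complex_banach)"
  using scaleC_add_right[of c x "- y"] by (simp add: scaleC_minus_right)

lemma bounded_linear_scaleC_right: "bounded_linear (\<lambda>x :: 'a::complex_banach. c *\<^sub>C x)"
proof (rule bounded_linear_intro[where K = "cmod c"])
  show "c *\<^sub>C (r *\<^sub>R x) = r *\<^sub>R (c *\<^sub>C x)" for r and x :: 'a
    by (metis scaleC_of_real scaleC_scaleC mult.commute)
qed (simp_all add: scaleC_add_right norm_scaleC mult.commute)

lemma id_blinfun_in_bounded_ops: "id_blinfun \<in> bounded_ops"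
  by (simp add: bounded_ops_def)

lemma compose_in_bounded_ops: "A \<in> bounded_ops \<Longrightarrow> B \<in> bounded_ops \<Longrightarrow> A o\<^sub>L B \<in> bounded_ops"
  by (simp add: bounded_ops_def)

lemma add_in_bounded_ops: "A \<in> bounded_ops \<Longrightarrow> B \<in> bounded_ops \<Longrightarrow> A + B \<in> bounded_ops"
  by (simp add: bounded_ops_def blinfun.add_left scaleC_add_right)

lemma diff_in_bounded_ops: "A \<in> bounded_ops \<Longrightarrow> B \<in> bounded_ops \<Longrightarrow> A - B \<in> bounded_ops"
  by (simp add: bounded_ops_def blinfun.diff_left scaleC_diff_right)

lemma scaleC_in_bounded_ops: "A \<in> bounded_ops \<Longrightarrow> c *\<^sub>C A \<in> bounded_ops"
  by (simp add: bounded_ops_def scaleC_blinfun.rep_eq scaleC_scaleC mult.commute)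

lemma word_op_in_bounded_ops:
  "a \<in> bounded_ops \<Longrightarrow> b \<in> bounded_ops \<Longrightarrow> word_op a b w \<in> bounded_ops"
  by (induction a b w rule: word_op.induct)
    (auto intro: id_blinfun_in_bounded_ops compose_in_bounded_ops)

text \<open>Complex-linearity is a closed condition: it is the vanishing of these functionals.\<close>

definition homogeneity_defect ::
  "complex \<Rightarrow> 'x \<Rightarrow> ('x::complex_banach \<Rightarrow>\<^sub>L 'x) \<Rightarrow> 'x" where
  "homogeneity_defect c x A = A (c *\<^sub>C x) - c *\<^sub>C A x"

lemma bounded_ops_iff_defect: "A \<in> bounded_ops \<longleftrightarrow> (\<forall>c x. homogeneity_defect c x A = 0)"
  by (simp add: bounded_ops_def homogeneity_defect_def)

lemma bounded_linear_homogeneity_defect: "bounded_linear (homogeneity_defect c x)"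
  unfolding homogeneity_defect_def
  by (intro bounded_linear_sub bounded_linear_compose[OF bounded_linear_scaleC_right]
      blinfun.bounded_linear_left)

text \<open>Each defect is a bounded linear map of the operator, so it passes through the sum. It
  vanishes termwise, and sums are unique.\<close>

lemma has_sum_in_bounded_ops:
  assumes "(f has_sum S) I" and "\<And>i. i \<in> I \<Longrightarrow> f i \<in> bounded_ops"
  shows "S \<in> bounded_ops"
  unfolding bounded_ops_iff_defect
proof (intro allI)
  fix c x
  have "((\<lambda>i. homogeneity_defect c x (f i)) has_sum homogeneity_defect c x S) I"
    by (rule has_sum_bounded_linear[OF bounded_linear_homogeneity_defect assms(1)])
  moreover have "((\<lambda>i. homogeneity_defect c x (f i)) has_sum 0) I"
    using assms(2) by (intro has_sum_0) (simp add: bounded_ops_iff_defect)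
  ultimately show "homogeneity_defect c x S = 0"
    by (rule has_sum_unique)
qed

lemma has_integral_in_bounded_ops:
  assumes "(f has_integral J) S" and "\<And>t. t \<in> S \<Longrightarrow> f t \<in> bounded_ops"
  shows "J \<in> bounded_ops"
  unfolding bounded_ops_iff_defect
proof (intro allI)
  fix c x
  have "((homogeneity_defect c x \<circ> f) has_integral homogeneity_defect c x J) S"
    by (rule has_integral_linear[OF assms(1) bounded_linear_homogeneity_defect])
  moreover have "((homogeneity_defect c x \<circ> f) has_integral 0) S"
    using assms(2) by (intro has_integral_is_0) (simp add: bounded_ops_iff_defect)
  ultimately show "homogeneity_defect c x J = 0"
    by (rule has_integral_unique)
qed

section \<open>Complex-linearity of inverses, resolvents and logarithms\<close>

lemma op_inverse_unique:
  assumes "is_op_inverse A B" and "is_op_inverse A C"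
  shows "B = C"
proof (rule blinfun_eqI)
  fix x
  have "A (C x) = x" and "B (A (C x)) = C x"
    using assms unfolding is_op_inverse_def
    by (metis blinfun_apply_blinfun_compose blinfun_apply_id_blinfun id_apply)+
  then show "B x = C x"
    by simp
qed

lemma op_inverse_in_bounded_ops:
  assumes "is_op_inverse A B" and "A \<in> bounded_ops"
  shows "B \<in> bounded_ops"
proof -
  have AB: "A (B x) = x" and BA: "B (A x) = x" for x
    using assms(1) unfolding is_op_inverse_def
    by (metis blinfun_apply_blinfun_compose blinfun_apply_id_blinfun id_apply)+
  \<comment> \<open>Since A is complex-linear, A maps c (B x) to c (A (B x)) = c x; applying B
    recovers c (B x).\<close>
  have "B (c *\<^sub>C x) = c *\<^sub>C B x" for c x
    using BA[of "c *\<^sub>C B x"] by (simp add: bounded_opsD[OF assms(2)] AB)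
  then show ?thesis
    by (simp add: bounded_ops_def)
qed

text \<open>\<open>resolvent\<close> is a definite description. Off the spectrum an inverse exists
  and is unique, so the description denotes it.\<close>

lemma resolvent_in_bounded_ops:
  assumes "A \<in> bounded_ops" and "z \<notin> op_spectrum A"
  shows "resolvent A z \<in> bounded_ops"
proof -
  obtain B where B: "is_op_inverse (z *\<^sub>C id_blinfun - A) B"
    using assms(2) by (auto simp: op_spectrum_def)
  then have "resolvent A z = B"
    unfolding resolvent_def by (blast intro: the_equality op_inverse_unique)
  then show ?thesis
    using op_inverse_in_bounded_ops[OF B] assms(1)
    by (simp add: diff_in_bounded_ops scaleC_in_bounded_ops id_blinfun_in_bounded_ops)
qed

lemma riesz_dunford_in_bounded_ops:
  assumes "has_riesz_dunford \<Omega> f A B" and A: "A \<in> bounded_ops"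
  shows "B \<in> bounded_ops"
proof -
  obtain \<gamma> J where \<gamma>: "dunford_contour \<Omega> A \<gamma>"
    and J: "((\<lambda>x. (f (\<gamma> x) * vector_derivative \<gamma> (at x within {0..1})) *\<^sub>C resolvent A (\<gamma> x))
              has_integral J) {0..1}"
    and B: "B = (1 / (2 * of_real pi * \<i>)) *\<^sub>C J"
    using assms(1) by (auto simp: has_riesz_dunford_def)
  \<comment> \<open>The contour avoids the spectrum at every parameter, so each value of the
    integrand is a complex scalar times a genuine resolvent.\<close>
  have "\<gamma> t \<notin> op_spectrum A" if "t \<in> {0..1}" for t
    using \<gamma> that unfolding dunford_contour_def path_image_def by blast
  then have "J \<in> bounded_ops"
    by (intro has_integral_in_bounded_ops[OF J] scaleC_in_bounded_ops resolvent_in_bounded_ops A)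
  then show ?thesis
    by (simp add: B scaleC_in_bounded_ops)
qed

lemma op_Log_evolution_in_bounded_ops:
  assumes "evolution_operator T U" and "0 \<le> s" "s \<le> t" "t \<le> T"
    and "has_op_Log (U t s + \<kappa> *\<^sub>C id_blinfun) L"
  shows "L \<in> bounded_ops"
proof (rule riesz_dunford_in_bounded_ops)
  show "has_riesz_dunford (- \<real>\<^sub>\<le>\<^sub>0) Ln (U t s + \<kappa> *\<^sub>C id_blinfun) L"
    using assms(5) by (simp add: has_op_Log_def)
  show "U t s + \<kappa> *\<^sub>C id_blinfun \<in> bounded_ops"
    using assms(1-4)
    by (auto simp: evolution_operator_def
        intro: add_in_bounded_ops scaleC_in_bounded_ops id_blinfun_in_bounded_ops)
qed

section \<open>The conjugation series\<close>

abbreviation op_power :: "('x::complex_banach \<Rightarrow>\<^sub>L 'x) \<Rightarrow> nat \<Rightarrow> ('x \<Rightarrow>\<^sub>L 'x)" where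
  "op_power A n \<equiv> ((o\<^sub>L) A ^^ n) id_blinfun"

lemma norm_op_power: "norm (op_power A n) \<le> norm A ^ n"
proof (induction n)
  case 0
  \<comment> \<open>Only an inequality: on the zero space the identity has norm 0.\<close>
  show ?case
    by (simp add: norm_blinfun_id_le)
next
  case (Suc n)
  have "norm (op_power A (Suc n)) \<le> norm A * norm (op_power A n)"
    by (simp add: norm_blinfun_compose)
  also have "\<dots> \<le> norm A * norm A ^ n"
    by (rule mult_left_mono[OF Suc.IH]) simp
  finally show ?case
    by simp
qed

text \<open>Moves the signs of the series for exp(-a) into the scalars, so that only powers of a
  itself remain.\<close>

lemma op_power_uminus: "op_power (- A) n = (- 1) ^ n *\<^sub>R op_power A n"
proof (induction n)
  case (Suc n)
  then show ?case
    by (auto intro!: blinfun_eqI simp: blinfun.bilinear_simps)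
qed simp

lemma op_exp_abs_summable: "(\<lambda>n. norm ((1 / fact n) *\<^sub>R op_power A n)) summable_on UNIV"
proof (rule Infinite_Sum.abs_summable_on_comparison_test')
  show "(\<lambda>n. norm A ^ n / fact n) summable_on UNIV"
    using summable_exp[of "norm A"]
    by (subst summable_on_UNIV_nonneg_real_iff) (simp_all add: field_simps)
  show "norm ((1 / fact n) *\<^sub>R op_power A n) \<le> norm A ^ n / fact n" for n
    using norm_op_power[of n A] by (simp add: divide_right_mono)
qed

text \<open>\<open>op_exp\<close> is an ordered series. Absolute convergence makes it an unordered
  sum with the same value, which can then be regrouped.\<close>

lemma op_exp_has_sum: "((\<lambda>n. (1 / fact n) *\<^sub>R op_power A n) has_sum op_exp A) UNIV"
  (is "(?f has_sum _) UNIV")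
proof -
  have f: "(?f has_sum (\<Sum>\<^sub>\<infinity>n. ?f n)) UNIV"
    by (rule has_sum_infsum[OF abs_summable_summable[OF op_exp_abs_summable]])
  have "op_exp A = (\<Sum>\<^sub>\<infinity>n. ?f n)"
    unfolding op_exp_def by (rule sums_unique[symmetric, OF has_sum_imp_sums[OF f]])
  with f show ?thesis
    by simp
qed

text \<open>Cauchy product without diagonals: boundedness in each argument evaluates the rows and
  then the sum of the rows.\<close>

lemma bounded_bilinear_has_sum:
  fixes f :: "'i \<Rightarrow> 'a::banach" and g :: "'j \<Rightarrow> 'b::banach"
    and prod :: "'a \<Rightarrow> 'b \<Rightarrow> 'c::banach"
  assumes prod: "bounded_bilinear prod"
    and f: "(f has_sum F) A" "(\<lambda>i. norm (f i)) summable_on A"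
    and g: "(g has_sum G) B" "(\<lambda>j. norm (g j)) summable_on B"
  shows "((\<lambda>(i, j). prod (f i) (g j)) has_sum prod F G) (A \<times> B)"
proof (rule has_sum_SigmaI)
  interpret bounded_bilinear prod by (rule prod)
  show "((\<lambda>j. case (i, j) of (i, j) \<Rightarrow> prod (f i) (g j)) has_sum prod (f i) G) B" for i
    using has_sum_bounded_linear[OF bounded_linear_right g(1)] by simp
  show "((\<lambda>i. prod (f i) G) has_sum prod F G) A"
    by (rule has_sum_bounded_linear[OF bounded_linear_left f(1)])
  \<comment> \<open>Iterated sums alone do not give an unordered double sum; the double family is
    dominated by K times the summable products of norms.\<close>
  obtain K where K: "\<And>a b. norm (prod a b) \<le> norm a * norm b * K"
    using bounded by blast
  have "(\<lambda>(i, j). norm (f i) * norm (g j)) summable_on A \<times> B"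
  proof (rule summable_on_SigmaI)
    show "((\<lambda>j. case (i, j) of (i, j) \<Rightarrow> norm (f i) * norm (g j))
            has_sum norm (f i) * (\<Sum>\<^sub>\<infinity>j\<in>B. norm (g j))) B" for i
      using g(2) by (simp add: has_sum_cmult_right)
    show "(\<lambda>i. norm (f i) * (\<Sum>\<^sub>\<infinity>j\<in>B. norm (g j))) summable_on A"
      using f(2) by (rule summable_on_cmult_left)
  qed auto
  then have "(\<lambda>p. (case p of (i, j) \<Rightarrow> norm (f i) * norm (g j)) * K) summable_on A \<times> B"
    by (rule summable_on_cmult_left)
  then have "(\<lambda>p. norm (case p of (i, j) \<Rightarrow> prod (f i) (g j))) summable_on A \<times> B"
    by (rule Infinite_Sum.abs_summable_on_comparison_test') (auto simp: K)
  then show "(\<lambda>(i, j). prod (f i) (g j)) summable_on A \<times> B"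
    by (rule abs_summable_summable)
qed

section \<open>The conjugation series indexed by words\<close>

definition conj_coeff :: "nat \<Rightarrow> nat \<Rightarrow> real" where
  "conj_coeff j k = (- 1) ^ k / (fact j * fact k)"

definition conj_word :: "nat \<Rightarrow> nat \<Rightarrow> letter list" where
  "conj_word j k = replicate j Fst @ Snd # replicate k Fst"

lemma word_op_append: "word_op a b (v @ w) = word_op a b v o\<^sub>L word_op a b w"
proof (induction v)
  case (Cons l v)
  then show ?case
    by (cases l) (auto intro: blinfun_eqI)
qed (auto intro: blinfun_eqI)

lemma word_op_replicate_Fst: "word_op a b (replicate n Fst) = op_power a n"
  by (induction n) simp_all

lemma word_op_conj_word: "word_op a b (conj_word j k) = op_power a j o\<^sub>L (b o\<^sub>L op_power a k)"
  by (simp add: conj_word_def word_op_append word_op_replicate_Fst)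

lemma length_conj_word: "length (conj_word j k) = Suc (j + k)"
  by (simp add: conj_word_def)

text \<open>The initial run of \<open>Fst\<close> determines j, and the total length then determines
  k. Hence the sum over pairs can be reindexed by words without collecting terms.\<close>

lemma conj_word_eq_iff: "conj_word j k = conj_word j' k' \<longleftrightarrow> j = j' \<and> k = k'"
proof
  assume eq: "conj_word j k = conj_word j' k'"
  have "takeWhile (\<lambda>l. l = Fst) (conj_word i l) = replicate i Fst" for i l
    unfolding conj_word_def by (subst takeWhile_append2) auto
  then have "replicate j Fst = replicate j' Fst"
    using eq by metis
  then have "j = j'"
    by (metis length_replicate)
  then show "j = j' \<and> k = k'"
    using eq length_conj_word by (metis add_left_cancel nat.inject)
qed simp

lemma conjugation_has_sum:
  "((\<lambda>(j, k). conj_coeff j k *\<^sub>R word_op a b (conj_word j k))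
     has_sum (op_exp a o\<^sub>L b o\<^sub>L op_exp (- a))) UNIV"
proof -
  have "bounded_bilinear (\<lambda>A B. A o\<^sub>L b o\<^sub>L B)"
    by (rule bounded_bilinear.comp1[OF bounded_bilinear_blinfun_compose
          bounded_bilinear.bounded_linear_left[OF bounded_bilinear_blinfun_compose]])
  from bounded_bilinear_has_sum[OF this op_exp_has_sum[of a] op_exp_abs_summable
      op_exp_has_sum[of "- a"] op_exp_abs_summable]
  have "((\<lambda>(j, k). ((1 / fact j) *\<^sub>R op_power a j) o\<^sub>L b o\<^sub>L ((1 / fact k) *\<^sub>R op_power (- a) k))
     has_sum (op_exp a o\<^sub>L b o\<^sub>L op_exp (- a))) UNIV"
    by simp
  moreover have "((1 / fact j) *\<^sub>R op_power a j) o\<^sub>L b o\<^sub>L ((1 / fact k) *\<^sub>R op_power (- a) k)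
      = conj_coeff j k *\<^sub>R word_op a b (conj_word j k)" for j k
    by (rule blinfun_eqI)
      (simp add: op_power_uminus word_op_conj_word conj_coeff_def blinfun.scaleR_left
        blinfun.scaleR_right)
  ultimately show ?thesis
    by simp
qed

text \<open>The word \<open>a\<^sup>j b a\<^sup>k\<close> has degree \<open>j + k + 1\<close>, hence the bound 3.\<close>

definition remainder_pairs :: "(nat \<times> nat) set" where
  "remainder_pairs = {(j, k). 3 \<le> j + k}"

text \<open>At most one pair matches a given word, so the sum selects its coefficient, or is 0 for
  every other word. No inverse of \<open>conj_word\<close> has to be chosen.\<close>

definition remainder_coeff :: "letter list \<Rightarrow> complex" where
  "remainder_coeff w = (\<Sum>(j, k) | 3 \<le> j + k \<and> w = conj_word j k. complex_of_real (conj_coeff j k))"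

lemma remainder_coeff_conj_word:
  "(j, k) \<in> remainder_pairs \<Longrightarrow> remainder_coeff (conj_word j k) = complex_of_real (conj_coeff j k)"
proof -
  assume "(j, k) \<in> remainder_pairs"
  then have "{(j', k'). 3 \<le> j' + k' \<and> conj_word j k = conj_word j' k'} = {(j, k)}"
    by (simp add: conj_word_eq_iff remainder_pairs_def) fastforce
  then show ?thesis
    by (simp add: remainder_coeff_def)
qed

lemma remainder_coeff_eq_0:
  assumes "w \<notin> case_prod conj_word ` remainder_pairs"
  shows "remainder_coeff w = 0"
proof -
  have "w \<noteq> conj_word j k" if "3 \<le> j + k" for j k
    using assms that by (auto simp: remainder_pairs_def)
  then have "{(j, k). 3 \<le> j + k \<and> w = conj_word j k} = {}"
    by blast
  then show ?thesis
    unfolding remainder_coeff_def by (simp only: sum.empty)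
qed

lemma remainder_coeff_low_order: "length w < 4 \<Longrightarrow> remainder_coeff w = 0"
  by (rule remainder_coeff_eq_0) (auto simp: remainder_pairs_def length_conj_word)

section \<open>Separating the low-order terms from the remainder\<close>

lemma low_order_pairs: "- remainder_pairs = {(0, 0), (0, 1), (1, 0), (0, 2), (1, 1), (2, 0)}"
proof (rule set_eqI, clarify)
  fix j k
  show "(j, k) \<in> - remainder_pairs \<longleftrightarrow> (j, k) \<in> {(0, 0), (0, 1), (1, 0), (0, 2), (1, 1), (2, 0)}"
    by (simp add: remainder_pairs_def) presburger
qed

text \<open>By degree, the six words give b, then ab - ba, then aab/2 - aba + baa/2, which is half
  of the double commutator.\<close>

lemma low_order_sum:
  "(\<Sum>(j, k)\<in>- remainder_pairs. conj_coeff j k *\<^sub>R word_op a b (conj_word j k))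
     = b + commutator a b + (1/2) *\<^sub>R commutator a (commutator a b)"
proof (rule blinfun_eqI)
  fix x
  \<comment> \<open>Here p, y, q stand for aab, aba, baa applied to x. The two copies of y absorb
    the factor 1/2, leaving the coefficients of the pairs (2,0), (1,1), (0,2).\<close>
  have half: "(1/2) *\<^sub>R (p - y - (y - q)) = (1/2) *\<^sub>R p - y + (1/2) *\<^sub>R q" for p q y :: 'a
  proof -
    have "u - v - (v - w) = u - (v + v) + w" for u v w :: 'a
      by (simp add: algebra_simps)
    moreover have "(1/2) *\<^sub>R y + (1/2) *\<^sub>R y = y"
      by (simp flip: scaleR_add_left)
    ultimately show ?thesis
      by (simp only: scaleR_diff_right scaleR_add_right)
  qed
  show "blinfun_apply (\<Sum>(j, k)\<in>- remainder_pairs. conj_coeff j k *\<^sub>R word_op a b (conj_word j k)) x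
      = blinfun_apply (b + commutator a b + (1/2) *\<^sub>R commutator a (commutator a b)) x"
    by (simp add: low_order_pairs word_op_conj_word conj_coeff_def commutator_def
        eval_nat_numeral blinfun.add_left blinfun.diff_left blinfun.minus_left
        blinfun.diff_right blinfun.scaleR_left half)
qed

text \<open>Remove the finite low-order block from the conjugation series, carry the rest from pairs
  to words by injectivity, and extend it by zero to all words.\<close>

lemma remainder_has_sum:
  "((\<lambda>w. remainder_coeff w *\<^sub>C word_op a b w) has_sum
     ((op_exp a o\<^sub>L b o\<^sub>L op_exp (- a))
       - (b + commutator a b + (1/2) *\<^sub>R commutator a (commutator a b)))) UNIV"
  (is "(?f has_sum ?R) UNIV")
proof -
  let ?g = "\<lambda>(j, k). conj_coeff j k *\<^sub>R word_op a b (conj_word j k)"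
  have inj: "inj_on (case_prod conj_word) remainder_pairs"
    by (auto simp: inj_on_def conj_word_eq_iff)
  have "(?g has_sum (b + commutator a b + (1/2) *\<^sub>R commutator a (commutator a b)))
          (- remainder_pairs)"
    by (rule has_sum_finiteI) (simp add: low_order_pairs, rule low_order_sum[symmetric])
  from has_sum_Diff[OF conjugation_has_sum this subset_UNIV]
  have "(?g has_sum ?R) (UNIV - - remainder_pairs)" .
  also have "UNIV - - remainder_pairs = remainder_pairs"
    by auto
  also have "(?g has_sum ?R) remainder_pairs \<longleftrightarrow> ((?f \<circ> case_prod conj_word) has_sum ?R) remainder_pairs"
    by (rule has_sum_cong) (auto simp: remainder_coeff_conj_word scaleC_of_real)
  also have "\<dots> \<longleftrightarrow> (?f has_sum ?R) (case_prod conj_word ` remainder_pairs)"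
    by (rule has_sum_reindex[OF inj, symmetric])
  also have "\<dots> \<longleftrightarrow> (?f has_sum ?R) UNIV"
  proof (rule has_sum_cong_neutral)
    fix w
    assume "w \<in> UNIV - case_prod conj_word ` remainder_pairs"
    then show "?f w = 0"
      using scaleC_of_real[of 0 "word_op a b w"] by (simp add: remainder_coeff_eq_0)
  qed auto
  finally show ?thesis .
qed

theorem theorem3:
  fixes U1 U2 a1 a2 :: "real \<Rightarrow> real \<Rightarrow> ('x::complex_banach \<Rightarrow>\<^sub>L 'x)"
    and D1 D2 :: "real \<Rightarrow> 'x set"
    and A1 A2 :: "real \<Rightarrow> 'x \<Rightarrow> 'x"
    and T :: real
    and \<kappa> :: complex
  assumes "0 < T"
    and "evolution_operator T U1" and "generates T D1 A1 U1"
    and "evolution_operator T U2" and "generates T D2 A2 U2"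
    and "\<And>t s. 0 \<le> s \<Longrightarrow> s \<le> t \<Longrightarrow> t \<le> T \<Longrightarrow>
           has_op_Log (U1 t s + \<kappa> *\<^sub>C id_blinfun) (a1 t s)"
    and "\<And>t s. 0 \<le> s \<Longrightarrow> s \<le> t \<Longrightarrow> t \<le> T \<Longrightarrow>
           has_op_Log (U2 t s + \<kappa> *\<^sub>C id_blinfun) (a2 t s)"
  shows "\<exists>(R4 :: real \<Rightarrow> real \<Rightarrow> ('x \<Rightarrow>\<^sub>L 'x)) (c :: letter list \<Rightarrow> complex).
           \<forall>t s. 0 \<le> s \<and> s \<le> t \<and> t \<le> T \<longrightarrow>
             op_exp (a1 t s) o\<^sub>L a2 t s o\<^sub>L op_exp (- a1 t s)
               = a2 t s + commutator (a1 t s) (a2 t s)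
                 + (1/2) *\<^sub>R commutator (a1 t s) (commutator (a1 t s) (a2 t s))
                 + R4 t s
             \<and> R4 t s \<in> bounded_ops
             \<and> sum_of_terms_of_order_ge 4 c (a1 t s) (a2 t s) (R4 t s)"
proof (intro exI allI impI, elim conjE)
  fix t s :: real
  assume ts: "0 \<le> s" "s \<le> t" "t \<le> T"
  let ?main = "\<lambda>t s. a2 t s + commutator (a1 t s) (a2 t s)
    + (1/2) *\<^sub>R commutator (a1 t s) (commutator (a1 t s) (a2 t s))"
  \<comment> \<open>Defining the remainder as the difference makes the identity immediate; its order
    comes from \<open>remainder_has_sum\<close>. The witnesses precede t and s, so \<open>?R\<close>
    is a function of both, while one coefficient family serves all times.\<close>
  let ?R = "\<lambda>t s. (op_exp (a1 t s) o\<^sub>L a2 t s o\<^sub>L op_exp (- a1 t s)) - ?main t s"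
  have "a1 t s \<in> bounded_ops" "a2 t s \<in> bounded_ops"
    using assms ts by (blast intro: op_Log_evolution_in_bounded_ops)+
  then have "?R t s \<in> bounded_ops"
    by (intro has_sum_in_bounded_ops[OF remainder_has_sum] scaleC_in_bounded_ops
        word_op_in_bounded_ops)
  moreover have "sum_of_terms_of_order_ge 4 remainder_coeff (a1 t s) (a2 t s) (?R t s)"
    unfolding sum_of_terms_of_order_ge_def
    using remainder_coeff_low_order remainder_has_sum by blast
  moreover have "op_exp (a1 t s) o\<^sub>L a2 t s o\<^sub>L op_exp (- a1 t s) = ?main t s + ?R t s"
    by (simp add: algebra_simps)
  ultimately show "op_exp (a1 t s) o\<^sub>L a2 t s o\<^sub>L op_exp (- a1 t s) = ?main t s + ?R t s
      \<and> ?R t s \<in> bounded_ops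
      \<and> sum_of_terms_of_order_ge 4 remainder_coeff (a1 t s) (a2 t s) (?R t s)"
    by (intro conjI)
qed

end
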